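(* Let $G$ be a finite abstract simplicial complex. For all real $t$, $$\sum_{x\in G}\sum_{y\in G}g_t(x,y)=1-f_G(t),$$ where $g_t(x,y)=\omega(x)\,\omega(y)\,\bigl(1-f_{W^+(x)\cap W^+(y)}(t)\bigr)$.
   Context: A finite abstract simplicial complex $G$ is a finite set of finite non-empty sets closed under the operation of taking non-empty subsets. For $x\in G$ let $W^+(x)=\{y\in G: x\subset y\}$ (including $x$). Let $|x|$ be the cardinality of $x$, $\dim(x)=|x|-1$ and $\omega(x)=(-1)^{\dim(x)}$. For any subset $A\subset G$ (not necessarily a subcomplex), $f_A(t)=1+f_0t+f_1t^2+\cdots+f_dt^{d+1}$, where $f_k$ is the number of elements of $A$ of dimension $k$; that is, $f_A(t)=1+\sum_{x\in A}t^{|x|}$, with $f_\emptyset(t)=1$. *)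

theory Defs
  imports Complex_Main
begin

definition abstract_simplicial_complex :: "'a set set \<Rightarrow> bool" where
  "abstract_simplicial_complex G \<longleftrightarrow>
     finite G \<and>
     (\<forall>x\<in>G. finite x \<and> x \<noteq> {}) \<and>
     (\<forall>x\<in>G. \<forall>y. y \<subseteq> x \<longrightarrow> y \<noteq> {} \<longrightarrow> y \<in> G)"

text \<open>Natural-number subtraction truncates only at the empty set, which is never a simplex.\<close>

definition simplex_dim :: "'a set \<Rightarrow> nat" where
  "simplex_dim x = card x - 1"

definition \<omega> :: "'a set \<Rightarrow> real" where
  "\<omega> x = (-1) ^ simplex_dim x"

text \<open>The inclusion is non-strict, so \<open>x\<close> itself belongs to its star.\<close>

definition star :: "'a set set \<Rightarrow> 'a set \<Rightarrow> 'a set set" where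
  "star G x = {y\<in>G. x \<subseteq> y}"

definition f_number :: "'a set set \<Rightarrow> nat \<Rightarrow> nat" where
  "f_number A k = card {x\<in>A. simplex_dim x = k}"

definition f_fun :: "'a set set \<Rightarrow> real \<Rightarrow> real" where
  "f_fun A t = 1 + (\<Sum>x\<in>A. t ^ card x)"

text \<open>The simplex sum is the polynomial \<open>1 + f\<^sub>0 t + \<dots> + f\<^sub>d t\<^sup>d\<^sup>+\<^sup>1\<close>, for any
  upper bound \<open>d\<close> on the dimensions occurring in \<open>A\<close>.\<close>

lemma f_fun_eq_f_number:
  assumes "finite A" and "\<And>x. x \<in> A \<Longrightarrow> finite x \<and> x \<noteq> {}"
    and "\<And>x. x \<in> A \<Longrightarrow> simplex_dim x \<le> d"
  shows "f_fun A t = 1 + (\<Sum>k\<le>d. real (f_number A k) * t ^ (k + 1))"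
proof -
  have card_eq: "card x = simplex_dim x + 1" if "x \<in> A" for x
    using assms(2)[OF that] by (simp add: simplex_dim_def card_gt_0_iff Suc_leI)
  have "(\<Sum>x\<in>A. t ^ card x) = (\<Sum>x\<in>A. t ^ (simplex_dim x + 1))"
    by (rule sum.cong) (simp_all add: card_eq)
  also have "\<dots> = (\<Sum>k\<le>d. \<Sum>x\<in>{x\<in>A. simplex_dim x = k}. t ^ (simplex_dim x + 1))"
    by (rule sum.group[symmetric]) (use assms in auto)
  also have "\<dots> = (\<Sum>k\<le>d. real (f_number A k) * t ^ (k + 1))"
    by (rule sum.cong) (simp_all add: f_number_def)
  finally show ?thesis
    by (simp add: f_fun_def)
qed

definition green :: "'a set set \<Rightarrow> real \<Rightarrow> 'a set \<Rightarrow> 'a set \<Rightarrow> real" where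
  "green G t x y = \<omega> x * \<omega> y * (1 - f_fun (star G x \<inter> star G y) t)"

end

theory Submission
  imports Defs
begin

text \<open>Each entry of the matrix is a sum over the common cofaces of \<open>x\<close> and \<open>y\<close>,
  namely \<open>- \<omega> x * \<omega> y * t ^ card z\<close> summed over the simplices \<open>z\<close> containing both.
  Exchanging summations, every \<open>z\<close> contributes \<open>- t ^ card z\<close> times the square of the sum
  of \<open>\<omega>\<close> over the faces of \<open>z\<close>: for a given \<open>z\<close> the conditions on \<open>x\<close> and \<open>y\<close> are
  independent, so the double sum factors. Closure of \<open>G\<close> under taking faces makes the inner
  sum the Euler characteristic of a full simplex (\<open>sum_\<omega>_faces\<close>), which is 1. What is left
  is the sum of \<open>- t ^ card z\<close> over \<open>G\<close>.\<close>

text \<open>Expanding \<open>(1 - 1) ^ card z\<close> over the subsets of \<open>z\<close>.\<close>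

lemma sum_Pow_alternating:
  assumes "finite z" and "z \<noteq> {}"
  shows "(\<Sum>x\<in>Pow z. (-1) ^ card x) = (0 :: real)"
proof -
  have "(\<Sum>x\<in>Pow z. (-1) ^ card x) = (\<Prod>i\<in>z. (-1) + (1 :: real))"
    by (subst prod_add) (simp_all add: assms)
  then show ?thesis
    using assms by (simp add: card_gt_0_iff)
qed

text \<open>The full alternating sum over subsets vanishes, and \<open>\<omega>\<close> carries the opposite sign;
  leaving out the empty set therefore leaves its summand 1.\<close>

lemma sum_\<omega>_faces:
  assumes "finite z" and "z \<noteq> {}"
  shows "(\<Sum>x\<in>Pow z - {{}}. \<omega> x) = 1"
proof -
  have "\<omega> x = - ((-1) ^ card x)" if "x \<in> Pow z - {{}}" for x
  proof -
    have "finite x" "x \<noteq> {}"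
      using that assms(1) finite_subset by auto
    then obtain n where "card x = Suc n"
      by (metis card_0_eq not0_implies_Suc)
    then show ?thesis
      by (simp add: \<omega>_def simplex_dim_def)
  qed
  then have "(\<Sum>x\<in>Pow z - {{}}. \<omega> x) = - (\<Sum>x\<in>Pow z - {{}}. (-1) ^ card x)"
    by (simp add: sum_negf)
  also have "\<dots> = 1"
    using assms sum_Pow_alternating[OF assms] by (simp add: sum_diff1)
  finally show ?thesis .
qed

lemma faces_eq:
  assumes "abstract_simplicial_complex G" and "z \<in> G"
  shows "{x \<in> G. x \<subseteq> z} = Pow z - {{}}"
  using assms unfolding abstract_simplicial_complex_def by auto

lemma green_eq_sum_cofaces:
  assumes "finite G"
  shows "green G t x y =
    - (\<Sum>z\<in>G. t ^ card z * ((if x \<subseteq> z then \<omega> x else 0) * (if y \<subseteq> z then \<omega> y else 0)))"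
proof -
  have "star G x \<inter> star G y = {z \<in> G. x \<subseteq> z \<and> y \<subseteq> z}"
    by (auto simp: star_def)
  then have "green G t x y = - (\<omega> x * \<omega> y * (\<Sum>z\<in>G. if x \<subseteq> z \<and> y \<subseteq> z then t ^ card z else 0))"
    using assms by (simp add: green_def f_fun_def sum.inter_filter)
  also have "\<dots> = - (\<Sum>z\<in>G. t ^ card z *
      ((if x \<subseteq> z then \<omega> x else 0) * (if y \<subseteq> z then \<omega> y else 0)))"
    unfolding sum_distrib_left by (intro arg_cong[where f = uminus] sum.cong) auto
  finally show ?thesis .
qed

theorem theorem10:
  fixes G :: "'a set set" and t :: real
  assumes "abstract_simplicial_complex G"
  shows "(\<Sum>x\<in>G. \<Sum>y\<in>G. green G t x y) = 1 - f_fun G t"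
proof -
  define w where "w z x = (if x \<subseteq> z then \<omega> x else 0)" for z x :: "'a set"
  have fin: "finite G"
    using assms by (simp add: abstract_simplicial_complex_def)
  have sum_w: "(\<Sum>x\<in>G. w z x) = 1" if "z \<in> G" for z
  proof -
    have "(\<Sum>x\<in>G. w z x) = (\<Sum>x\<in>{x \<in> G. x \<subseteq> z}. \<omega> x)"
      unfolding w_def using fin by (simp add: sum.inter_filter)
    also have "\<dots> = 1"
      unfolding faces_eq[OF assms that]
      using assms that by (intro sum_\<omega>_faces) (auto simp: abstract_simplicial_complex_def)
    finally show ?thesis .
  qed
  have "(\<Sum>x\<in>G. \<Sum>y\<in>G. green G t x y) =
      - (\<Sum>x\<in>G. \<Sum>y\<in>G. \<Sum>z\<in>G. t ^ card z * (w z x * w z y))"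
    by (simp add: green_eq_sum_cofaces[OF fin] w_def sum_negf)
  also have "(\<Sum>x\<in>G. \<Sum>y\<in>G. \<Sum>z\<in>G. t ^ card z * (w z x * w z y)) =
      (\<Sum>x\<in>G. \<Sum>z\<in>G. \<Sum>y\<in>G. t ^ card z * (w z x * w z y))"
    by (intro sum.cong refl sum.swap)
  also have "\<dots> = (\<Sum>z\<in>G. \<Sum>x\<in>G. \<Sum>y\<in>G. t ^ card z * (w z x * w z y))"
    by (rule sum.swap)
  also have "\<dots> = (\<Sum>z\<in>G. t ^ card z * ((\<Sum>x\<in>G. w z x) * (\<Sum>y\<in>G. w z y)))"
    unfolding sum_product by (simp only: sum_distrib_left)
  also have "\<dots> = (\<Sum>z\<in>G. t ^ card z)"
    by (simp add: sum_w)
  finally show ?thesis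
    by (simp add: f_fun_def)
qed

end
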